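(* Let $\mathbf{U}=(\mathbf{T},G,H)$ be an $\mathrm{itKI}_{c1}$-algebra. Then the maps $S\mapsto D_S=\{u\in T:\ \sim u\Rightarrow c\in S\text{ and }1\Rightarrow(u\vee c)\in S\}$ and $D\mapsto S_D=D\cap C(T)$ establish an order isomorphism between the lattice of tense 1-filters of $\mathrm{C}(\mathbf{U})$ and the lattice of centered tense deductive systems of $\mathbf{U}$.
   Context: A centered Kleene algebra is $\langle T,\wedge,\vee,\sim,c,0,1\rangle$ with bounded distributive lattice reduct, $\sim\sim x=x$, $\sim(x\vee y)=\sim x\wedge\sim y$, $x\wedge\sim x\le y\vee\sim y$, $\sim c=c$. A KI-algebra is $\langle T,\wedge,\vee,\Rightarrow,\sim,c,0,1\rangle$ with centered Kleene reduct such that: $(a\Rightarrow b)\wedge(a\Rightarrow d)=a\Rightarrow(b\wedge d)$, $(a\Rightarrow d)\wedge(b\Rightarrow d)=(a\vee b)\Rightarrow d$, $0\Rightarrow a=1$, $a\Rightarrow 1=1$; $(x\wedge(x\Rightarrow y))\vee c\le y\vee c$; $c\Rightarrow c=1$; $(x\Rightarrow y)\wedge c=(\sim x\vee y)\wedge c$; $(x\Rightarrow\sim y)\vee c=(x\Rightarrow(\sim y\vee c))\wedge(y\Rightarrow(\sim x\vee c))$. A tense centered KI-algebra is $(\mathbf{T},G,H)$ with $F(x):=\sim G(\sim x)$, $P(x):=\sim H(\sim x)$ satisfying $G(1)=H(1)=1$; $G,H$ preserve $\wedge$; $x\le GP(x)$, $x\le HF(x)$; $G(x\vee y)\le G(x)\vee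 F(y)$, $H(x\vee y)\le H(x)\vee P(y)$; $G(x\Rightarrow y)\le G(x)\Rightarrow G(y)$, $H(x\Rightarrow y)\le H(x)\Rightarrow H(y)$; $G(x\Rightarrow y)\le F(x)\Rightarrow F(y)$, $H(x\Rightarrow y)\le P(x)\Rightarrow P(y)$; $G(c)=c=H(c)$. An $\mathrm{itKI}_{c1}$-algebra is a tense centered KI-algebra satisfying $x\Rightarrow x=1$ and (CK): for all $x,y\ge c$ with $x\wedge y\le c$ there is $z$ with $z\vee c=x$ and $\sim z\vee c=y$. $C(T)=\{x\in T:x\ge c\}$; $\mathrm{C}(\mathbf{U})$ is $C(T)$ with $\wedge,\vee,\Rightarrow,G,H,F,P$ restricted, bottom $c$, top $1$. A tense 1-filter of $\mathrm{C}(\mathbf{U})$ is a lattice filter $S$ of $C(T)$ with $((a\wedge f)\Rightarrow b)\Rightarrow(a\Rightarrow b)\in S$ for all $a,b\in C(T)$, $f\in S$, and closed under $G,H$. A tense deductive system of $\mathbf{U}$ is $D\subseteq T$ with $1\in D$; $u,u\Rightarrow v\in D$ implies $v\in D$; $u\in D$ implies $G(u),H(u)\in D$. It is centered if $D\cap C(T)$ is a tense 1-filter of $\mathrm{C}(\mathbf{U})$ and for every $u\in T$, $\sim u\Rightarrow c\in D$ and $1\Rightarrow(u\vee c)\in D$ imply $u\in D$. Both lattices are ordered by inclusion. *)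

theory Defs
  imports "HOL-Algebra.Lattice"
begin

(* HOL-Algebra is only used for the lattice predicate on orders with a carrier; its operation
   names and notation would otherwise shadow those of the HOL lattice type classes. *)
hide_const (open) Lattice.inf Lattice.sup Order.top
no_notation Lattice.meet (infixl \<open>\<sqinter>\<index>\<close> 70)
no_notation Lattice.join (infixl \<open>\<squnion>\<index>\<close> 65)
notation inf (infixl \<open>\<sqinter>\<close> 70)
notation sup (infixl \<open>\<squnion>\<close> 65)

section \<open>Tense centered KI-algebras\<close>

text \<open>
  The universe \<open>T\<close> of an algebra is a type, and its bounded distributive lattice reduct is given by
  the type classes; \<open>0\<close> and \<open>1\<close> are \<^term>\<open>bot\<close> and \<^term>\<open>top\<close>, and the order
  is the lattice order. The implication \<open>\<Rightarrow>\<close> is written \<open>\<leadsto>\<close>.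
\<close>

locale centered_kleene_algebra =
  fixes neg :: "'a::{distrib_lattice, bounded_lattice} \<Rightarrow> 'a" (\<open>\<sim> _\<close> [81] 80)
    and c :: 'a
  assumes neg_neg: "\<sim> (\<sim> x) = x"
    and neg_sup: "\<sim> (x \<squnion> y) = (\<sim> x) \<sqinter> (\<sim> y)"
    and kleene: "x \<sqinter> (\<sim> x) \<le> y \<squnion> (\<sim> y)"
    and neg_center: "\<sim> c = c"

locale KI_algebra = centered_kleene_algebra neg c
  for neg :: "'a::{distrib_lattice, bounded_lattice} \<Rightarrow> 'a" (\<open>\<sim> _\<close> [81] 80)
    and c :: 'a +
  fixes imp :: "'a \<Rightarrow> 'a \<Rightarrow> 'a" (infixr \<open>\<leadsto>\<close> 60)
  assumes imp_inf: "(a \<leadsto> b) \<sqinter> (a \<leadsto> d) = (a \<leadsto> (b \<sqinter> d))"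
    and sup_imp: "(a \<leadsto> d) \<sqinter> (b \<leadsto> d) = ((a \<squnion> b) \<leadsto> d)"
    and bot_imp: "(bot \<leadsto> a) = top"
    and imp_top: "(a \<leadsto> top) = top"
    and imp_mp: "(x \<sqinter> (x \<leadsto> y)) \<squnion> c \<le> y \<squnion> c"
    and center_imp_center: "(c \<leadsto> c) = top"
    and imp_inf_center: "(x \<leadsto> y) \<sqinter> c = ((\<sim> x) \<squnion> y) \<sqinter> c"
    and imp_neg_sup_center:
      "(x \<leadsto> (\<sim> y)) \<squnion> c = (x \<leadsto> ((\<sim> y) \<squnion> c)) \<sqinter> (y \<leadsto> ((\<sim> x) \<squnion> c))"

text \<open>The operators of the tense axioms are \<open>F = dual_op neg G\<close> and \<open>P = dual_op neg H\<close>.\<close>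

definition dual_op :: "('a \<Rightarrow> 'a) \<Rightarrow> ('a \<Rightarrow> 'a) \<Rightarrow> 'a \<Rightarrow> 'a" where
  "dual_op neg K x = neg (K (neg x))"

locale tense_centered_KI_algebra = KI_algebra neg c imp
  for neg :: "'a::{distrib_lattice, bounded_lattice} \<Rightarrow> 'a" (\<open>\<sim> _\<close> [81] 80)
    and c :: 'a
    and imp :: "'a \<Rightarrow> 'a \<Rightarrow> 'a" (infixr \<open>\<leadsto>\<close> 60) +
  fixes G :: "'a \<Rightarrow> 'a" and H :: "'a \<Rightarrow> 'a"
  assumes G_top: "G top = top" and H_top: "H top = top"
    and G_inf: "G (x \<sqinter> y) = G x \<sqinter> G y" and H_inf: "H (x \<sqinter> y) = H x \<sqinter> H y"
    and le_GP: "x \<le> G (dual_op neg H x)" and le_HF: "x \<le> H (dual_op neg G x)"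
    and G_sup: "G (x \<squnion> y) \<le> G x \<squnion> dual_op neg G y"
    and H_sup: "H (x \<squnion> y) \<le> H x \<squnion> dual_op neg H y"
    and G_imp: "G (x \<leadsto> y) \<le> (G x \<leadsto> G y)" and H_imp: "H (x \<leadsto> y) \<le> (H x \<leadsto> H y)"
    and G_imp_F: "G (x \<leadsto> y) \<le> (dual_op neg G x \<leadsto> dual_op neg G y)"
    and H_imp_P: "H (x \<leadsto> y) \<le> (dual_op neg H x \<leadsto> dual_op neg H y)"
    and G_center: "G c = c" and H_center: "H c = c"

locale itKI_c1_algebra = tense_centered_KI_algebra neg c imp G H
  for neg :: "'a::{distrib_lattice, bounded_lattice} \<Rightarrow> 'a" (\<open>\<sim> _\<close> [81] 80)
    and c :: 'a
    and imp :: "'a \<Rightarrow> 'a \<Rightarrow> 'a" (infixr \<open>\<leadsto>\<close> 60)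
    and G :: "'a \<Rightarrow> 'a" and H :: "'a \<Rightarrow> 'a" +
  assumes imp_refl: "(x \<leadsto> x) = top"
    and CK: "\<lbrakk>c \<le> x; c \<le> y; x \<sqinter> y \<le> c\<rbrakk> \<Longrightarrow> \<exists>z. z \<squnion> c = x \<and> (\<sim> z) \<squnion> c = y"

section \<open>Tense 1-filters and centered tense deductive systems\<close>

definition lattice_filter_on :: "'a::lattice set \<Rightarrow> 'a set \<Rightarrow> bool" where
  "lattice_filter_on A S \<longleftrightarrow> S \<subseteq> A \<and> S \<noteq> {} \<and>
     (\<forall>x\<in>S. \<forall>y\<in>S. x \<sqinter> y \<in> S) \<and> (\<forall>x\<in>S. \<forall>y\<in>A. x \<le> y \<longrightarrow> y \<in> S)"

text \<open>
  Below, \<open>C(T)\<close> is the set \<^term>\<open>{c..}\<close>. The operations of \<open>C(U)\<close> are restrictions of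
  those of \<open>U\<close>, so they are represented by the latter applied to elements of \<open>{c..}\<close>.
\<close>

definition tense_1_filter ::
  "'a::lattice \<Rightarrow> ('a \<Rightarrow> 'a \<Rightarrow> 'a) \<Rightarrow> ('a \<Rightarrow> 'a) \<Rightarrow> ('a \<Rightarrow> 'a) \<Rightarrow> 'a set \<Rightarrow> bool" where
  "tense_1_filter c imp G H S \<longleftrightarrow> lattice_filter_on {c..} S \<and>
     (\<forall>a\<in>{c..}. \<forall>b\<in>{c..}. \<forall>f\<in>S. imp (imp (a \<sqinter> f) b) (imp a b) \<in> S) \<and>
     (\<forall>x\<in>S. G x \<in> S \<and> H x \<in> S)"

definition tense_deductive_system ::
  "('a::order_top \<Rightarrow> 'a \<Rightarrow> 'a) \<Rightarrow> ('a \<Rightarrow> 'a) \<Rightarrow> ('a \<Rightarrow> 'a) \<Rightarrow> 'a set \<Rightarrow> bool" where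
  "tense_deductive_system imp G H D \<longleftrightarrow> top \<in> D \<and>
     (\<forall>u v. u \<in> D \<and> imp u v \<in> D \<longrightarrow> v \<in> D) \<and>
     (\<forall>u\<in>D. G u \<in> D \<and> H u \<in> D)"

definition centered_tense_deductive_system ::
  "('a::bounded_lattice \<Rightarrow> 'a) \<Rightarrow> 'a \<Rightarrow> ('a \<Rightarrow> 'a \<Rightarrow> 'a) \<Rightarrow> ('a \<Rightarrow> 'a) \<Rightarrow> ('a \<Rightarrow> 'a) \<Rightarrow> 'a set \<Rightarrow> bool" where
  "centered_tense_deductive_system neg c imp G H D \<longleftrightarrow>
     tense_deductive_system imp G H D \<and> tense_1_filter c imp G H (D \<inter> {c..}) \<and>
     (\<forall>u. imp (neg u) c \<in> D \<and> imp top (u \<squnion> c) \<in> D \<longrightarrow> u \<in> D)"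

definition ded_of_filter ::
  "('a::bounded_lattice \<Rightarrow> 'a) \<Rightarrow> 'a \<Rightarrow> ('a \<Rightarrow> 'a \<Rightarrow> 'a) \<Rightarrow> 'a set \<Rightarrow> 'a set" where
  "ded_of_filter neg c imp S = {u. imp (neg u) c \<in> S \<and> imp top (u \<squnion> c) \<in> S}"

definition filter_of_ded :: "'a::order \<Rightarrow> 'a set \<Rightarrow> 'a set" where
  "filter_of_ded c D = D \<inter> {c..}"

definition tense_1_filters ::
  "'a::lattice \<Rightarrow> ('a \<Rightarrow> 'a \<Rightarrow> 'a) \<Rightarrow> ('a \<Rightarrow> 'a) \<Rightarrow> ('a \<Rightarrow> 'a) \<Rightarrow> 'a set set" where
  "tense_1_filters c imp G H = {S. tense_1_filter c imp G H S}"

definition centered_tense_deductive_systems ::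
  "('a::bounded_lattice \<Rightarrow> 'a) \<Rightarrow> 'a \<Rightarrow> ('a \<Rightarrow> 'a \<Rightarrow> 'a) \<Rightarrow> ('a \<Rightarrow> 'a) \<Rightarrow> ('a \<Rightarrow> 'a) \<Rightarrow> 'a set set" where
  "centered_tense_deductive_systems neg c imp G H =
     {D. centered_tense_deductive_system neg c imp G H D}"

definition inclusion_order :: "'a set set \<Rightarrow> 'a set gorder" where
  "inclusion_order X = \<lparr>carrier = X, eq = (=), le = (\<subseteq>)\<rparr>"

end

theory Submission
  imports Defs
begin

text \<open>
  The key observation is that membership in \<open>D\<^sub>S\<close> only depends on \<open>u \<squnion> c\<close>: if \<open>u \<squnion> c \<in> S\<close>,
  then, as \<open>(u \<squnion> c) \<sqinter> (\<sim> u \<squnion> c) = c\<close> by the Kleene law, the 1-filter condition for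
  \<open>a = \<sim> u \<squnion> c\<close>, \<open>f = u \<squnion> c\<close>, \<open>b = c\<close> puts \<open>\<sim> u \<leadsto> c\<close> into \<open>S\<close>; moreover a 1-filter contains \<open>x\<close>
  iff it contains \<open>1 \<leadsto> x\<close>. Hence \<open>D\<^sub>S = {u. u \<squnion> c \<in> S}\<close>, and a centered deductive system is
  likewise determined by its elements above \<open>c\<close>. Both families are closed under intersections.
\<close>

text \<open>Binary meets are intersections. The join of \<open>A\<close> and \<open>B\<close> is the
  intersection of all members containing both, and \<open>U\<close> ensures that this family is
  nonempty.\<close>

lemma lattice_inclusion_order:
  assumes U: "U \<in> X" "\<And>A. A \<in> X \<Longrightarrow> A \<subseteq> U"
    and Inter: "\<And>Y. Y \<subseteq> X \<Longrightarrow> Y \<noteq> {} \<Longrightarrow> \<Inter>Y \<in> X"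
  shows "lattice (inclusion_order X)"
proof -
  interpret partial_order "inclusion_order X"
    by unfold_locales (auto simp: inclusion_order_def)
  show ?thesis
  proof
    fix A B assume "A \<in> carrier (inclusion_order X)" "B \<in> carrier (inclusion_order X)"
    then have AB: "A \<in> X" "B \<in> X" by (auto simp: inclusion_order_def)
    have "\<Inter>{Z\<in>X. A \<subseteq> Z \<and> B \<subseteq> Z} \<in> X"
      by (rule Inter) (use U AB in auto)
    with AB show "\<exists>s. least (inclusion_order X) s (Upper (inclusion_order X) {A, B})"
      by (intro exI[of _ "\<Inter>{Z\<in>X. A \<subseteq> Z \<and> B \<subseteq> Z}"])
        (auto simp: inclusion_order_def least_def Upper_def)
    have "\<Inter>{A, B} \<in> X"
      by (rule Inter) (use AB in auto)
    with AB show "\<exists>s. greatest (inclusion_order X) s (Lower (inclusion_order X) {A, B})"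
      by (intro exI[of _ "A \<inter> B"]) (auto simp: inclusion_order_def greatest_def Lower_def)
  qed
qed

section \<open>Closure properties of tense 1-filters\<close>

lemma tense_1_filter_subset: "tense_1_filter c imp G H S \<Longrightarrow> S \<subseteq> {c..}"
  by (simp add: tense_1_filter_def lattice_filter_on_def)

lemma tense_1_filter_upward:
  "tense_1_filter c imp G H S \<Longrightarrow> x \<in> S \<Longrightarrow> x \<le> y \<Longrightarrow> c \<le> y \<Longrightarrow> y \<in> S"
  by (simp add: tense_1_filter_def lattice_filter_on_def)

lemma tense_1_filter_inf:
  "tense_1_filter c imp G H S \<Longrightarrow> x \<in> S \<Longrightarrow> y \<in> S \<Longrightarrow> x \<sqinter> y \<in> S"
  by (simp add: tense_1_filter_def lattice_filter_on_def)

lemma tense_1_filter_top: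
  fixes c :: "'a::bounded_lattice"
  assumes S: "tense_1_filter c imp G H S"
  shows "top \<in> S"
proof -
  have "S \<noteq> {}"
    using S unfolding tense_1_filter_def lattice_filter_on_def by (elim conjE)
  then obtain x where "x \<in> S" by blast
  then show ?thesis by (rule tense_1_filter_upward[OF S]) simp_all
qed

text \<open>Every condition is a closure condition and so passes to intersections, except
  nonemptiness, which holds because \<open>top\<close> lies in every tense 1-filter.\<close>

lemma tense_1_filter_Inter:
  fixes c :: "'a::bounded_lattice"
  assumes Y: "Y \<noteq> {}" and filters: "\<And>S. S \<in> Y \<Longrightarrow> tense_1_filter c imp G H S"
  shows "tense_1_filter c imp G H (\<Inter>Y)"
  unfolding tense_1_filter_def lattice_filter_on_def
proof (intro conjI ballI impI)
  show "\<Inter>Y \<noteq> {}" using tense_1_filter_top[OF filters] by blast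
  show "\<Inter>Y \<subseteq> {c..}" using tense_1_filter_subset[OF filters] Y by blast
  show "y \<in> \<Inter>Y" if "x \<in> \<Inter>Y" "y \<in> {c..}" "x \<le> y" for x y
    using tense_1_filter_upward[OF filters] that by (meson InterE InterI atLeast_iff)
  show "x \<sqinter> y \<in> \<Inter>Y" if "x \<in> \<Inter>Y" "y \<in> \<Inter>Y" for x y
    using tense_1_filter_inf[OF filters] that by (meson InterE InterI)
  show "imp (imp (a \<sqinter> f) b) (imp a b) \<in> \<Inter>Y"
    if "a \<in> {c..}" "b \<in> {c..}" "f \<in> \<Inter>Y" for a b f
    using filters that unfolding tense_1_filter_def by (meson InterE InterI)
  show "G x \<in> \<Inter>Y" "H x \<in> \<Inter>Y" if "x \<in> \<Inter>Y" for x
    using filters that unfolding tense_1_filter_def by (meson InterE InterI)+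
qed

section \<open>Implications whose consequent lies above the center\<close>

context KI_algebra
begin

lemma imp_mono: "b \<le> d \<Longrightarrow> (a \<leadsto> b) \<le> (a \<leadsto> d)"
  by (metis imp_inf inf.absorb_iff1 inf.absorb_iff2)

text \<open>By \<open>imp_inf_center\<close> the meet of the implication with \<open>c\<close> is
  \<open>((\<sim> x) \<squnion> y) \<sqinter> c\<close>, which is \<open>c\<close> once
  \<open>y\<close> is above \<open>c\<close>.\<close>

lemma center_le_imp: "c \<le> y \<Longrightarrow> c \<le> (x \<leadsto> y)"
  by (metis imp_inf_center inf.absorb_iff2 sup.coboundedI2)

lemma center_imp: "c \<le> y \<Longrightarrow> (c \<leadsto> y) = top"
  by (metis imp_mono center_imp_center top_unique)

text \<open>The left side splits by \<open>sup_imp\<close> into a meet whose factor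
  \<open>c \<leadsto> y\<close> is \<open>top\<close>. This lets antecedents be moved into
  \<open>{c..}\<close>, where the 1-filter condition applies.\<close>

lemma sup_center_imp: "c \<le> y \<Longrightarrow> ((x \<squnion> c) \<leadsto> y) = (x \<leadsto> y)"
  by (metis center_imp inf_top_right sup_imp)

lemma inf_imp_le: "c \<le> y \<Longrightarrow> x \<sqinter> (x \<leadsto> y) \<le> y"
  by (metis imp_mp le_sup_iff sup.absorb1)

lemma top_imp_le: "c \<le> y \<Longrightarrow> (top \<leadsto> y) \<le> y"
  using inf_imp_le[of y top] by simp

lemma sup_center_inf_neg_sup_center: "((\<sim> u) \<squnion> c) \<sqinter> (u \<squnion> c) = c"
proof -
  have "u \<sqinter> (\<sim> u) \<le> c" using kleene[of u c] by (simp add: neg_center)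
  then have "((\<sim> u) \<sqinter> u) \<squnion> c = c" by (simp add: inf_commute sup.absorb2)
  then show ?thesis by (simp add: sup_inf_distrib2)
qed

end

section \<open>The two maps and their compositions\<close>

context itKI_c1_algebra
begin

text \<open>This is the greatest tense 1-filter. \<open>G\<close> and \<open>H\<close> preserve
  meets, hence are monotone, and they fix \<open>c\<close>.\<close>

lemma tense_1_filter_center: "tense_1_filter c imp G H {c..}"
proof -
  have "c \<le> G x \<and> c \<le> H x" if "c \<le> x" for x
    using that by (metis G_center G_inf H_center H_inf inf.absorb_iff1 inf.absorb_iff2)
  then show ?thesis
    unfolding tense_1_filter_def lattice_filter_on_def by (simp add: center_le_imp)
qed

lemma mem_ded_of_filter_iff:
  assumes S: "tense_1_filter c imp G H S"
  shows "u \<in> ded_of_filter neg c imp S \<longleftrightarrow> u \<squnion> c \<in> S"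
proof -
  note up = tense_1_filter_upward[OF S]
  \<comment> \<open>The 1-filter condition first yields
    \<open>top \<leadsto> (a \<leadsto> b)\<close>; the outer \<open>top\<close> is stripped by
    \<open>top_imp_le\<close>, since \<open>a \<leadsto> b\<close> is above
    \<open>c\<close>.\<close>
  have detach: "(a \<leadsto> b) \<in> S" if "f \<in> S" "c \<le> a" "c \<le> b" "((a \<sqinter> f) \<leadsto> b) = top" for a b f
  proof -
    have "(top \<leadsto> (a \<leadsto> b)) \<in> S"
      using S that unfolding tense_1_filter_def by (metis atLeast_iff)
    then show ?thesis using up top_imp_le center_le_imp that by blast
  qed
  show ?thesis
  proof
    assume "u \<in> ded_of_filter neg c imp S"
    then show "u \<squnion> c \<in> S"
      unfolding ded_of_filter_def by (blast intro: up top_imp_le sup_ge2)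
  next
    assume u: "u \<squnion> c \<in> S"
    \<comment> \<open>Here \<open>a\<close> is \<open>top\<close> and both \<open>f\<close> and
      \<open>b\<close> are \<open>u \<squnion> c\<close>.\<close>
    have "(top \<leadsto> (u \<squnion> c)) \<in> S"
      by (rule detach[OF u]) (simp_all add: imp_refl)
    moreover have "(((\<sim> u) \<squnion> c) \<leadsto> c) \<in> S"
      by (rule detach[OF u]) (simp_all add: sup_center_inf_neg_sup_center imp_refl)
    ultimately show "u \<in> ded_of_filter neg c imp S"
      by (simp add: ded_of_filter_def sup_center_imp)
  qed
qed

lemma filter_of_ded_of_filter:
  assumes S: "tense_1_filter c imp G H S"
  shows "filter_of_ded c (ded_of_filter neg c imp S) = S"
proof -
  have "S \<subseteq> {c..}" using tense_1_filter_subset[OF S] .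
  then show ?thesis
    by (auto simp: filter_of_ded_def mem_ded_of_filter_iff[OF S] sup.absorb1)
qed

lemma centered_ded_of_filter:
  assumes S: "tense_1_filter c imp G H S"
  shows "centered_tense_deductive_system neg c imp G H (ded_of_filter neg c imp S)"
proof -
  let ?D = "ded_of_filter neg c imp S"
  note mem = mem_ded_of_filter_iff[OF S]
  note up = tense_1_filter_upward[OF S]
  have op: "G x \<in> S" "H x \<in> S" if "x \<in> S" for x
    using S that unfolding tense_1_filter_def by auto
  have "top \<in> ?D" using tense_1_filter_top[OF S] by (simp add: mem)
  moreover have "v \<in> ?D" if "u \<in> ?D" "(u \<leadsto> v) \<in> ?D" for u v
  proof -
    \<comment> \<open>This moves the implication above \<open>c\<close>, so that detachment can be
      carried out inside the lattice filter \<open>S\<close> by \<open>inf_imp_le\<close>.\<close>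
    have "((u \<leadsto> v) \<squnion> c) \<le> ((u \<squnion> c) \<leadsto> (v \<squnion> c))"
      by (simp add: sup_center_imp imp_mono center_le_imp)
    then have "((u \<squnion> c) \<leadsto> (v \<squnion> c)) \<in> S"
      using that(2) unfolding mem by (blast intro: up center_le_imp sup_ge2)
    then have "(u \<squnion> c) \<sqinter> ((u \<squnion> c) \<leadsto> (v \<squnion> c)) \<in> S"
      using that(1) unfolding mem by (blast intro: tense_1_filter_inf[OF S])
    then show ?thesis unfolding mem by (blast intro: up inf_imp_le sup_ge2)
  qed
  moreover have "G u \<in> ?D \<and> H u \<in> ?D" if "u \<in> ?D" for u
  proof -
    \<comment> \<open>\<open>F\<close> and \<open>P\<close> fix \<open>c\<close> because
      \<open>neg\<close>, \<open>G\<close> and \<open>H\<close> do, so these are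
      \<open>G_sup\<close> and \<open>H_sup\<close> with second argument \<open>c\<close>.\<close>
    have "G (u \<squnion> c) \<le> G u \<squnion> c" "H (u \<squnion> c) \<le> H u \<squnion> c"
      using G_sup[of u c] H_sup[of u c]
      by (simp_all add: dual_op_def neg_center G_center H_center)
    moreover have "G (u \<squnion> c) \<in> S" "H (u \<squnion> c) \<in> S"
      using that op by (simp_all add: mem)
    ultimately show ?thesis unfolding mem by (blast intro: up sup_ge2)
  qed
  moreover have "?D \<inter> {c..} = S"
    using filter_of_ded_of_filter[OF S] by (simp add: filter_of_ded_def)
  moreover have "u \<in> ?D" if "((\<sim> u) \<leadsto> c) \<in> ?D" "(top \<leadsto> (u \<squnion> c)) \<in> ?D" for u
  proof -
    \<comment> \<open>Both implications lie above \<open>c\<close>, where membership in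
      \<open>?D\<close> and in \<open>S\<close> coincide.\<close>
    have "((\<sim> u) \<leadsto> c) \<in> S" "(top \<leadsto> (u \<squnion> c)) \<in> S"
      using that by (simp_all add: mem sup.absorb1 center_le_imp)
    then show ?thesis by (simp add: ded_of_filter_def)
  qed
  ultimately show ?thesis
    using S unfolding centered_tense_deductive_system_def tense_deductive_system_def by metis
qed

text \<open>The inclusion into \<open>D\<close> is the centeredness condition. Conversely,
  \<open>u \<leadsto> (u \<squnion> c)\<close> is \<open>top\<close>, so \<open>D\<close> contains
  \<open>u \<squnion> c\<close> with \<open>u\<close> by detachment.\<close>

lemma ded_of_filter_of_ded:
  assumes D: "centered_tense_deductive_system neg c imp G H D"
  shows "ded_of_filter neg c imp (filter_of_ded c D) = D"
proof
  have S: "tense_1_filter c imp G H (filter_of_ded c D)"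
    using D by (simp add: centered_tense_deductive_system_def filter_of_ded_def)
  show "ded_of_filter neg c imp (filter_of_ded c D) \<subseteq> D"
    using D unfolding centered_tense_deductive_system_def filter_of_ded_def ded_of_filter_def by blast
  show "D \<subseteq> ded_of_filter neg c imp (filter_of_ded c D)"
  proof
    fix u assume u: "u \<in> D"
    have "(u \<leadsto> (u \<squnion> c)) = top"
      using imp_mono[of u "u \<squnion> c" u] by (simp add: imp_refl top_unique)
    then have "u \<squnion> c \<in> D"
      using D u unfolding centered_tense_deductive_system_def tense_deductive_system_def by metis
    then show "u \<in> ded_of_filter neg c imp (filter_of_ded c D)"
      by (simp add: mem_ded_of_filter_iff[OF S]) (simp add: filter_of_ded_def)
  qed
qed

section \<open>Lattice structure of the two families\<close>

lemma ded_of_filter_mem: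
  "S \<in> tense_1_filters c imp G H \<Longrightarrow>
    ded_of_filter neg c imp S \<in> centered_tense_deductive_systems neg c imp G H"
  by (simp add: tense_1_filters_def centered_tense_deductive_systems_def centered_ded_of_filter)

lemma filter_of_ded_mem:
  "D \<in> centered_tense_deductive_systems neg c imp G H \<Longrightarrow>
    filter_of_ded c D \<in> tense_1_filters c imp G H"
  by (simp add: tense_1_filters_def centered_tense_deductive_systems_def
      centered_tense_deductive_system_def filter_of_ded_def)

lemma lattice_tense_1_filters: "lattice (inclusion_order (tense_1_filters c imp G H))"
proof (rule lattice_inclusion_order)
  show "{c..} \<in> tense_1_filters c imp G H"
    by (simp add: tense_1_filters_def tense_1_filter_center)
next
  show "A \<subseteq> {c..}" if "A \<in> tense_1_filters c imp G H" for A
    using that tense_1_filter_subset unfolding tense_1_filters_def by blast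
  show "\<Inter>Y \<in> tense_1_filters c imp G H"
    if "Y \<subseteq> tense_1_filters c imp G H" "Y \<noteq> {}" for Y
    using that tense_1_filter_Inter[of Y] unfolding tense_1_filters_def by blast
qed

text \<open>The lattice structure is carried over from the filters: \<open>UNIV\<close> and each
  intersection of systems are exhibited as images of tense 1-filters under
  \<open>ded_of_filter\<close>.\<close>

lemma lattice_centered_tense_deductive_systems:
  "lattice (inclusion_order (centered_tense_deductive_systems neg c imp G H))"
proof (rule lattice_inclusion_order)
  have "ded_of_filter neg c imp {c..} = UNIV"
    by (auto simp: mem_ded_of_filter_iff[OF tense_1_filter_center])
  then show "UNIV \<in> centered_tense_deductive_systems neg c imp G H"
    using centered_ded_of_filter[OF tense_1_filter_center]
    by (simp add: centered_tense_deductive_systems_def)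
next
  fix Y assume Y: "Y \<subseteq> centered_tense_deductive_systems neg c imp G H" "Y \<noteq> {}"
  let ?S = "\<Inter>(filter_of_ded c ` Y)"
  \<comment> \<open>\<open>ded_of_filter\<close> is a preimage construction, hence commutes with
    intersections.\<close>
  have "ded_of_filter neg c imp ?S = (\<Inter>D\<in>Y. ded_of_filter neg c imp (filter_of_ded c D))"
    by (auto simp: ded_of_filter_def)
  also have "\<dots> = \<Inter>Y"
    using Y(1) ded_of_filter_of_ded
    by (auto simp: centered_tense_deductive_systems_def subset_iff)
  finally have "ded_of_filter neg c imp ?S = \<Inter>Y" .
  moreover have "tense_1_filter c imp G H ?S"
    using Y filter_of_ded_mem by (intro tense_1_filter_Inter) (auto simp only: tense_1_filters_def)
  ultimately show "\<Inter>Y \<in> centered_tense_deductive_systems neg c imp G H"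
    using centered_ded_of_filter[of ?S] by (simp add: centered_tense_deductive_systems_def)
qed auto

end

theorem theorem7p12:
  fixes neg :: "'a::{distrib_lattice, bounded_lattice} \<Rightarrow> 'a"
    and c :: 'a
    and imp :: "'a \<Rightarrow> 'a \<Rightarrow> 'a"
    and G H :: "'a \<Rightarrow> 'a"
  assumes "itKI_c1_algebra neg c imp G H"
  shows "lattice (inclusion_order (tense_1_filters c imp G H)) \<and>
    lattice (inclusion_order (centered_tense_deductive_systems neg c imp G H)) \<and>
    bij_betw (ded_of_filter neg c imp) (tense_1_filters c imp G H) (centered_tense_deductive_systems neg c imp G H) \<and>
    bij_betw (filter_of_ded c) (centered_tense_deductive_systems neg c imp G H) (tense_1_filters c imp G H) \<and>
    (\<forall>S\<in>tense_1_filters c imp G H. filter_of_ded c (ded_of_filter neg c imp S) = S) \<and>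
    (\<forall>D\<in>centered_tense_deductive_systems neg c imp G H. ded_of_filter neg c imp (filter_of_ded c D) = D) \<and>
    (\<forall>S\<in>tense_1_filters c imp G H. \<forall>S'\<in>tense_1_filters c imp G H.
       S \<subseteq> S' \<longleftrightarrow> ded_of_filter neg c imp S \<subseteq> ded_of_filter neg c imp S') \<and>
    (\<forall>D\<in>centered_tense_deductive_systems neg c imp G H. \<forall>D'\<in>centered_tense_deductive_systems neg c imp G H.
       D \<subseteq> D' \<longleftrightarrow> filter_of_ded c D \<subseteq> filter_of_ded c D')"
proof -
  interpret itKI_c1_algebra neg c imp G H by fact
  let ?\<S> = "tense_1_filters c imp G H"
  let ?\<D> = "centered_tense_deductive_systems neg c imp G H"
  have FD: "\<forall>S\<in>?\<S>. filter_of_ded c (ded_of_filter neg c imp S) = S"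
    by (simp add: tense_1_filters_def filter_of_ded_of_filter)
  have DF: "\<forall>D\<in>?\<D>. ded_of_filter neg c imp (filter_of_ded c D) = D"
    by (simp add: centered_tense_deductive_systems_def ded_of_filter_of_ded)
  have D_mono: "ded_of_filter neg c imp S \<subseteq> ded_of_filter neg c imp S'" if "S \<subseteq> S'" for S S'
    using that by (auto simp: ded_of_filter_def)
  have F_mono: "filter_of_ded c D \<subseteq> filter_of_ded c D'" if "D \<subseteq> D'" for D D'
    using that by (auto simp: filter_of_ded_def)
  have "bij_betw (ded_of_filter neg c imp) ?\<S> ?\<D>"
    by (rule bij_betw_byWitness[OF FD DF]) (use ded_of_filter_mem filter_of_ded_mem in auto)
  moreover have "bij_betw (filter_of_ded c) ?\<D> ?\<S>"
    by (rule bij_betw_byWitness[OF DF FD]) (use ded_of_filter_mem filter_of_ded_mem in auto)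
  \<comment> \<open>Inclusion is reflected because the inverse map is monotone as well.\<close>
  moreover have "\<forall>S\<in>?\<S>. \<forall>S'\<in>?\<S>.
      S \<subseteq> S' \<longleftrightarrow> ded_of_filter neg c imp S \<subseteq> ded_of_filter neg c imp S'"
    using D_mono F_mono FD by metis
  moreover have "\<forall>D\<in>?\<D>. \<forall>D'\<in>?\<D>. D \<subseteq> D' \<longleftrightarrow> filter_of_ded c D \<subseteq> filter_of_ded c D'"
    using D_mono F_mono DF by metis
  ultimately show ?thesis
    using FD DF lattice_tense_1_filters lattice_centered_tense_deductive_systems by blast
qed

end
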